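(* Let $G$ be a finite simple graph and let $\epsilon$ be an elementary harmonious homomorphism of $G$ identifying nonadjacent vertices $u$ and $v$ of $G$ with $d_G(u,v)\ge 3$. Then $$h(G)\le h(\epsilon(G))\le h(G)+\min\{\deg(u),\deg(v)\}+1.$$ Therefore, $h(G)\le h(\epsilon(G))\le h(G)+\Delta(G)+1$.
   Context: Graphs are finite and simple; $d_G(u,v)$ is the distance in $G$ (infinite if $u,v$ lie in different components), $\deg$ denotes degree in $G$ and $\Delta(G)$ the maximum degree. A harmonious $k$-coloring of a graph $G$ is a proper vertex coloring with $k$ colors such that every (unordered) pair of colors appears on at most one edge. The harmonious chromatic number $h(G)$ is the minimum $k$ such that $G$ has a harmonious $k$-coloring. An elementary harmonious homomorphism $\epsilon$ of $G$ identifying $u$ and $v$ (with $d_G(u,v)\geq 3$) maps both $u$ and $v$ to $u$ and fixes every vertex of $V(G)\setminus\{u,v\}$; its image $\epsilon(G)$ has vertex set $V(G)\setminus\{v\}$ and edge set $\{\epsilon(x)\epsilon(y): xy\in E(G)\}$. *)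

theory Defs
  imports "Graph_Theory.Pair_Digraph" "Graph_Theory.Shortest_Path"
begin

text \<open>
  Finite simple graphs are rendered by the locale \<^locale>\<open>pair_graph\<close>: finite, loop-free,
  symmetric digraphs without parallel arcs. An undirected edge \<open>xy\<close> is the pair of arcs
  \<open>(x, y)\<close>, \<open>(y, x)\<close>.
\<close>

definition edges :: "'a pair_pre_digraph \<Rightarrow> 'a set set" where
  "edges G = {{x, y} | x y. (x, y) \<in> parcs G}"

text \<open>By symmetry, the arcs leaving a vertex correspond bijectively to its incident edges.\<close>

definition degree :: "'a pair_pre_digraph \<Rightarrow> 'a \<Rightarrow> nat" where
  "degree G v = out_degree (with_proj G) v"

text \<open>Only meaningful for graphs with at least one vertex, because of \<^const>\<open>Max\<close>.\<close>

definition max_degree :: "'a pair_pre_digraph \<Rightarrow> nat" where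
  "max_degree G = Max (degree G ` pverts G)"

text \<open>
  The infimum of the lengths of all walks from \<open>u\<close> to \<open>v\<close> (each arc has weight 1);
  it is \<open>\<infinity>\<close> if there is no such walk.
\<close>

definition graph_dist :: "'a pair_pre_digraph \<Rightarrow> 'a \<Rightarrow> 'a \<Rightarrow> ereal" where
  "graph_dist G u v = wf_digraph.\<mu> (with_proj G) (\<lambda>_. 1) u v"

text \<open>
  The colours are \<open>{..<k}\<close>, not all of which need to be used. Since the colouring is proper,
  the case \<open>i = j\<close> of the last conjunct is vacuous.
\<close>

definition harmonious_coloring :: "'a pair_pre_digraph \<Rightarrow> nat \<Rightarrow> ('a \<Rightarrow> nat) \<Rightarrow> bool" where
  "harmonious_coloring G k c \<longleftrightarrow>
     (\<forall>x\<in>pverts G. c x < k) \<and>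
     (\<forall>x y. (x, y) \<in> parcs G \<longrightarrow> c x \<noteq> c y) \<and>
     (\<forall>i<k. \<forall>j<k. \<exists>\<^sub>\<le>\<^sub>1 e. e \<in> edges G \<and> c ` e = {i, j})"

definition harmonious_chromatic_number :: "'a pair_pre_digraph \<Rightarrow> nat" where
  "harmonious_chromatic_number G = (LEAST k. \<exists>c. harmonious_coloring G k c)"

text \<open>
  The values of \<open>\<epsilon>\<close> outside the vertex set are irrelevant. The vertices \<open>u\<close> and \<open>v\<close> are
  distinct because their distance is not 0.
\<close>

definition elementary_harmonious_hom ::
    "'a pair_pre_digraph \<Rightarrow> 'a \<Rightarrow> 'a \<Rightarrow> ('a \<Rightarrow> 'a) \<Rightarrow> bool" where
  "elementary_harmonious_hom G u v \<epsilon> \<longleftrightarrow>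
     u \<in> pverts G \<and> v \<in> pverts G \<and> graph_dist G u v \<ge> 3 \<and>
     \<epsilon> u = u \<and> \<epsilon> v = u \<and> (\<forall>x \<in> pverts G - {u, v}. \<epsilon> x = x)"

definition elementary_image ::
    "'a pair_pre_digraph \<Rightarrow> 'a \<Rightarrow> ('a \<Rightarrow> 'a) \<Rightarrow> 'a pair_pre_digraph" where
  "elementary_image G v \<epsilon> =
     \<lparr> pverts = pverts G - {v}, parcs = {(\<epsilon> x, \<epsilon> y) | x y. (x, y) \<in> parcs G} \<rparr>"

end

theory Submission
  imports Defs
begin

text \<open>
  A colouring is harmonious iff it is proper and the colour pair of an arc determines the arc
  (\<open>harmonious_coloring_iff_arc_inj\<close>); both bounds are proved in this form.

  For the lower bound, let \<open>c\<close> be a harmonious colouring of \<open>\<epsilon>(G)\<close>. As \<open>u\<close> and \<open>v\<close> are at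
  distance at least 3, they are nonadjacent and have no common neighbour, so \<open>\<epsilon>\<close> does not
  identify two different arcs of \<open>G\<close>. Hence \<open>c \<circ> \<epsilon>\<close> still distinguishes the arcs of \<open>G\<close>, with the same number of
  colours.

  For the upper bound, let \<open>c\<close> be a harmonious colouring of \<open>G\<close> and let \<open>w\<close> be either of \<open>u\<close>
  and \<open>v\<close>, and \<open>w'\<close> the other one. Give the merged vertex and the neighbours of \<open>w\<close> pairwise
  distinct fresh colours; this costs \<open>deg w + 1\<close> colours. A fresh colour determines its vertex,
  so a conflict can only arise between two arcs without freshly coloured ends, which are arcs
  of \<open>G\<close>, or between two arcs that leave the same freshly coloured vertex for vertices with old
  colours. If that vertex is a neighbour of \<open>w\<close>, these are again arcs of \<open>G\<close>. If it is the merged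
  vertex, the other ends are not neighbours of \<open>w\<close>, so they are neighbours of \<open>w'\<close> and have
  different colours under \<open>c\<close>. The choice of \<open>w\<close> with smaller degree gives the bound.
\<close>

section \<open>Harmonious colourings as arc-injective colourings\<close>

text \<open>
  Ordered colour pairs avoid the case distinction on how two unordered colour pairs are matched.
  The crossed matching is excluded in one direction by properness, and it is reduced to the
  straight one by symmetry in the other.
\<close>

lemma harmonious_coloring_iff_arc_inj:
  assumes "pair_graph G"
  shows "harmonious_coloring G k c \<longleftrightarrow>
    (\<forall>x\<in>pverts G. c x < k) \<and>
    (\<forall>x y. (x, y) \<in> parcs G \<longrightarrow> c x \<noteq> c y) \<and>
    (\<forall>x y x' y'. (x, y) \<in> parcs G \<longrightarrow> (x', y') \<in> parcs G \<longrightarrow>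
        c x = c x' \<longrightarrow> c y = c y' \<longrightarrow> x = x' \<and> y = y')"
    (is "_ \<longleftrightarrow> ?R \<and> ?P \<and> ?I")
proof -
  interpret pair_graph G by fact
  have "(\<forall>i<k. \<forall>j<k. \<exists>\<^sub>\<le>\<^sub>1 e. e \<in> edges G \<and> c ` e = {i, j}) \<longleftrightarrow> ?I" (is "?H \<longleftrightarrow> _")
    if R: ?R and P: ?P
  proof
    assume H: ?H
    show ?I
    proof (intro allI impI)
      fix x y x' y'
      assume a: "(x, y) \<in> parcs G" "(x', y') \<in> parcs G" "c x = c x'" "c y = c y'"
      then have "c x < k" "c y < k" using R in_arcsD1 in_arcsD2 by blast+
      then have "\<exists>\<^sub>\<le>\<^sub>1 e. e \<in> edges G \<and> c ` e = {c x, c y}" using H by blast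
      moreover have "{x, y} \<in> edges G \<and> c ` {x, y} = {c x, c y}"
        "{x', y'} \<in> edges G \<and> c ` {x', y'} = {c x, c y}"
        using a by (auto simp: edges_def)
      ultimately have "{x, y} = {x', y'}" by (rule Uniq_D)
      moreover have "c x \<noteq> c y" using a P by blast
      ultimately show "x = x' \<and> y = y'" using a(3) by (auto simp: doubleton_eq_iff)
    qed
  next
    assume I: ?I
    show ?H
    proof (intro allI impI Uniq_I)
      fix i j e e'
      assume "e \<in> edges G \<and> c ` e = {i, j}" "e' \<in> edges G \<and> c ` e' = {i, j}"
      then obtain x y x' y' where a: "e = {x, y}" "(x, y) \<in> parcs G" "e' = {x', y'}"
        "(x', y') \<in> parcs G" and "{c x, c y} = {c x', c y'}"
        unfolding edges_def by auto
      then consider "c x = c x'" "c y = c y'" | "c x = c y'" "c y = c x'"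
        by (auto simp: doubleton_eq_iff)
      then show "e = e'"
      proof cases
        case 1
        then show ?thesis using I a by blast
      next
        case 2
        moreover have "(y', x') \<in> parcs G" using a arcs_symmetric by blast
        ultimately have "x = y' \<and> y = x'" using I a by blast
        then show ?thesis using a by auto
      qed
    qed
  qed
  then show ?thesis unfolding harmonious_coloring_def by blast
qed

lemma harmonious_coloring_exists:
  assumes "pair_graph G"
  shows "\<exists>k c. harmonious_coloring G k c"
proof -
  interpret pair_graph G by fact
  obtain f and n :: nat where f: "f ` pverts G = {i. i < n}" "inj_on f (pverts G)"
    using finite_imp_inj_to_nat_seg[OF finite_verts] by auto
  have "f x < n" if "x \<in> pverts G" for x using that f(1) by blast
  moreover have "x = y" if "x \<in> pverts G" "y \<in> pverts G" "f x = f y" for x y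
    using that f(2) by (blast dest: inj_onD)
  ultimately have "harmonious_coloring G n f"
    unfolding harmonious_coloring_iff_arc_inj[OF assms]
    using in_arcsD1 in_arcsD2 no_loops' by blast
  then show ?thesis by blast
qed

lemma harmonious_chromatic_number_le:
  "harmonious_coloring G k c \<Longrightarrow> harmonious_chromatic_number G \<le> k"
  unfolding harmonious_chromatic_number_def by (blast intro: Least_le)

lemma harmonious_chromatic_number_attained:
  assumes "pair_graph G"
  shows "\<exists>c. harmonious_coloring G (harmonious_chromatic_number G) c"
  unfolding harmonious_chromatic_number_def
  using harmonious_coloring_exists[OF assms] by (rule LeastI_ex)

section \<open>Degrees and distances\<close>

lemma degree_eq_card_neighbours: "degree G w = card {y. (w, y) \<in> parcs G}"
proof -
  have "out_arcs (with_proj G) w = Pair w ` {y. (w, y) \<in> parcs G}"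
    by (auto simp: out_arcs_def)
  then show ?thesis
    by (simp add: degree_def out_degree_def card_image inj_on_def)
qed

lemma degree_le_max_degree:
  assumes "pair_graph G" "w \<in> pverts G"
  shows "degree G w \<le> max_degree G"
proof -
  interpret pair_graph G by fact
  show ?thesis using assms(2) by (simp add: max_degree_def)
qed

lemma graph_dist_le_walk_length:
  assumes "pair_graph G" "pre_digraph.awalk (with_proj G) u p v"
  shows "graph_dist G u v \<le> ereal (real (length p))"
proof -
  interpret pair_graph G by fact
  have "\<mu> (\<lambda>_. 1) u v \<le> awalk_cost (\<lambda>_. 1) p"
    using assms(2) by (rule min_cost_le_walk_cost)
  also have "awalk_cost (\<lambda>_. 1) p = real (length p)"
    by (simp add: awalk_cost_def sum_list_triv)
  finally show ?thesis by (simp add: graph_dist_def)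
qed

section \<open>Identifying two vertices at distance at least 3\<close>

locale vertex_identification = pair_graph G for G :: "'a pair_pre_digraph" +
  fixes u v :: 'a and \<epsilon> :: "'a \<Rightarrow> 'a"
  assumes hom: "elementary_harmonious_hom G u v \<epsilon>"
    and nonadjacent: "(u, v) \<notin> parcs G"
begin

abbreviation H :: "'a pair_pre_digraph" where "H \<equiv> elementary_image G v \<epsilon>"

lemma u_in_verts: "u \<in> pverts G" and v_in_verts: "v \<in> pverts G"
  using hom by (auto simp: elementary_harmonious_hom_def)

lemma eps_eq: "x \<in> pverts G \<Longrightarrow> \<epsilon> x = (if x = v then u else x)"
  using hom by (auto simp: elementary_harmonious_hom_def)

lemma nonadjacent_sym: "(v, u) \<notin> parcs G"
  using nonadjacent arcs_symmetric by blast

lemma no_short_walk: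
  assumes "awalk u p v"
  shows "length p \<ge> 3"
proof -
  have "3 \<le> graph_dist G u v" using hom by (simp add: elementary_harmonious_hom_def)
  also have "\<dots> \<le> ereal (real (length p))"
    using pair_graph_axioms assms by (rule graph_dist_le_walk_length)
  finally show ?thesis by simp
qed

lemma distinct: "u \<noteq> v"
  using no_short_walk[of "[]"] u_in_verts by (auto simp: awalk_Nil_iff)

lemma no_common_neighbour: "(u, y) \<in> parcs G \<Longrightarrow> (v, y) \<notin> parcs G"
proof
  assume "(u, y) \<in> parcs G" "(v, y) \<in> parcs G"
  then have "(u, y) \<in> parcs G" "(y, v) \<in> parcs G" using arcs_symmetric by blast+
  then have "awalk u [(u, y), (y, v)] v"
    using v_in_verts by (auto simp: awalk_Cons_iff awalk_Nil_iff)
  from no_short_walk[OF this] show False by simp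
qed

lemma arcs_image_iff:
  "(a, b) \<in> parcs H \<longleftrightarrow> a \<noteq> v \<and> b \<noteq> v \<and>
     ((a, b) \<in> parcs G \<or> a = u \<and> (v, b) \<in> parcs G \<or> b = u \<and> (a, v) \<in> parcs G)"
  (is "?L \<longleftrightarrow> ?R")
proof
  assume ?L
  then obtain x y where xy: "(x, y) \<in> parcs G" and ab: "a = \<epsilon> x" "b = \<epsilon> y"
    by (auto simp: elementary_image_def)
  have "\<epsilon> x = (if x = v then u else x)" "\<epsilon> y = (if y = v then u else y)"
    using eps_eq in_arcsD1[OF xy] in_arcsD2[OF xy] by blast+
  moreover have "(v, v) \<notin> parcs G" using no_loops' by blast
  ultimately show ?R using xy distinct unfolding ab by (auto split: if_splits)
next
  have arc: "((if x = v then u else x), (if y = v then u else y)) \<in> parcs H"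
    if xy: "(x, y) \<in> parcs G" for x y
  proof -
    have "(\<epsilon> x, \<epsilon> y) \<in> parcs H" using xy by (auto simp: elementary_image_def)
    then show ?thesis using eps_eq in_arcsD1[OF xy] in_arcsD2[OF xy] by simp
  qed
  assume ?R
  then show ?L using arc[of a b] arc[of v b] arc[of a v] by auto
qed

text \<open>
  Nonadjacency of \<open>u\<close> and \<open>v\<close> keeps the image free of loops.
\<close>

lemma pair_graph_image: "pair_graph H"
proof
  show "finite (pverts H)" by (simp add: elementary_image_def)
  show "finite (parcs H)"
  proof -
    have "parcs H = map_prod \<epsilon> \<epsilon> ` parcs G" by (force simp: elementary_image_def)
    then show ?thesis by simp
  qed
  have verts: "pverts H = pverts G - {v}" by (simp add: elementary_image_def)
  fix e
  assume e: "e \<in> parcs H"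
  obtain a b where ab: "e = (a, b)" by (cases e)
  show "fst e \<in> pverts H" "snd e \<in> pverts H" "fst e \<noteq> snd e"
    using e u_in_verts nonadjacent nonadjacent_sym
    unfolding ab arcs_image_iff verts by (auto dest: in_arcsD1 in_arcsD2 no_loops')
next
  have "sym (parcs H)" using arcs_symmetric by (auto simp: sym_def arcs_image_iff)
  then show "symmetric (with_proj H)" by (simp only: symmetric_def with_proj_simps)
qed

text \<open>
  Two different arcs with the same image must differ by exchanging \<open>u\<close> and \<open>v\<close> at one end or at
  both. At one end, this makes the other end a common neighbour of \<open>u\<close> and \<open>v\<close>; at both, it
  makes each of them an arc between \<open>u\<close> and \<open>v\<close> or a loop.
\<close>

lemma eps_inj_on_arcs:
  assumes "(x, y) \<in> parcs G" "(x', y') \<in> parcs G" "\<epsilon> x = \<epsilon> x'" "\<epsilon> y = \<epsilon> y'"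
  shows "x = x' \<and> y = y'"
proof -
  have no_common: "\<not> ((z, u) \<in> parcs G \<and> (z, v) \<in> parcs G)" for z
    using no_common_neighbour arcs_symmetric by blast
  have "x = x' \<or> x = u \<and> x' = v \<or> x = v \<and> x' = u"
    using assms(3) eps_eq in_arcsD1[OF assms(1)] in_arcsD1[OF assms(2)] by (simp split: if_splits)
  moreover have "y = y' \<or> y = u \<and> y' = v \<or> y = v \<and> y' = u"
    using assms(4) eps_eq in_arcsD2[OF assms(1)] in_arcsD2[OF assms(2)] by (simp split: if_splits)
  ultimately show ?thesis
    using assms(1,2) nonadjacent nonadjacent_sym no_common_neighbour no_common no_loops' by blast
qed

section \<open>Transfer of colourings along the identification\<close>

lemma harmonious_coloring_pullback:
  assumes "harmonious_coloring H k c"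
  shows "harmonious_coloring G k (c \<circ> \<epsilon>)"
proof -
  have arc: "(\<epsilon> x, \<epsilon> y) \<in> parcs H" if "(x, y) \<in> parcs G" for x y
    using that by (auto simp: elementary_image_def)
  have "\<epsilon> x \<in> pverts H" if "x \<in> pverts G" for x
    using that eps_eq distinct u_in_verts by (auto simp: elementary_image_def)
  then show ?thesis
    using assms arc eps_inj_on_arcs
    unfolding harmonious_coloring_iff_arc_inj[OF pair_graph_axioms]
      harmonious_coloring_iff_arc_inj[OF pair_graph_image] comp_def
    by blast
qed

text \<open>
  The \<open>deg w + 1\<close> fresh colours go to the set \<open>S\<close> of the merged vertex and the neighbours of
  \<open>w\<close>. The merged vertex alone would not do: a neighbour of \<open>u\<close> and a neighbour of \<open>v\<close> may
  have the same colour under \<open>c\<close>, and both become adjacent to it.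
\<close>

lemma harmonious_coloring_pushforward:
  assumes c: "harmonious_coloring G k c" and w: "w = u \<or> w = v"
  shows "\<exists>c'. harmonious_coloring H (k + degree G w + 1) c'"
proof -
  interpret H: pair_graph H by (rule pair_graph_image)
  define w' where "w' = (if w = u then v else u)"
  define N where "N = {y. (w, y) \<in> parcs G}"
  define S where "S = insert u N"
  have "N \<subseteq> pverts G" using in_arcsD2 by (auto simp: N_def)
  then have "finite N" using finite_verts by (rule finite_subset)
  moreover have "card N = degree G w" by (simp add: degree_eq_card_neighbours N_def)
  ultimately have "finite S" and card_S: "card S \<le> degree G w + 1"
    by (auto simp: S_def card_insert_if)
  then obtain f where "bij_betw f S {0..<card S}" using ex_bij_betw_finite_nat by blast
  then have f_inj: "inj_on f S" and "f ` S = {0..<card S}" by (auto simp: bij_betw_def)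
  then have f_less: "f x < card S" if "x \<in> S" for x using that by auto
  define c' where "c' x = (if x \<in> S then k + f x else c x)" for x

  note c_iff = c[unfolded harmonious_coloring_iff_arc_inj[OF pair_graph_axioms]]
  have c_less: "c x < k" if "x \<in> pverts G" for x
    using c_iff that by blast
  have c_proper: "c x \<noteq> c y" if "(x, y) \<in> parcs G" for x y
    using c_iff that by blast
  have c_inj: "x = x' \<and> y = y'"
    if "(x, y) \<in> parcs G" "(x', y') \<in> parcs G" "c x = c x'" "c y = c y'" for x y x' y'
    using c_iff that by blast
  have verts: "pverts H = pverts G - {v}" by (simp add: elementary_image_def)
  have arc_G: "(a, b) \<in> parcs G" if "(a, b) \<in> parcs H" "a \<noteq> u" "b \<noteq> u" for a b
    using that by (auto simp: arcs_image_iff)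
  have arc_w': "(w', b) \<in> parcs G" if "(u, b) \<in> parcs H" "b \<notin> S" for b
    using that w by (auto simp: arcs_image_iff S_def N_def w'_def)

  have fresh: "a \<in> S \<longleftrightarrow> a' \<in> S"
    if "a \<in> pverts H" "a' \<in> pverts H" "c' a = c' a'" for a a'
    using that c_less[of a] c_less[of a'] by (auto simp: c'_def verts split: if_splits)
  have fresh_inj: "a = a'" if "a \<in> S" "a' \<in> S" "c' a = c' a'" for a a'
    using that f_inj by (auto simp: c'_def dest: inj_onD)

  \<comment> \<open>The only arcs of the image that are new are those at \<open>u\<close> that come from \<open>v\<close>. Since \<open>S\<close>
     contains all neighbours of \<open>w\<close>, the arcs from \<open>u\<close> to vertices outside \<open>S\<close> all come from
     the single vertex \<open>w'\<close>, where \<open>c\<close> separates them.\<close>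
  have mixed: "b = b'"
    if "(a, b) \<in> parcs H" "(a, b') \<in> parcs H" "b \<notin> S" "b' \<notin> S" "c' b = c' b'" for a b b'
  proof -
    have "b \<noteq> u" "b' \<noteq> u" "c b = c b'" using that by (auto simp: S_def c'_def)
    then show ?thesis
      using that arc_w'[of b] arc_w'[of b'] arc_G[of a b] arc_G[of a b'] c_inj by blast
  qed

  have "c' a < k + degree G w + 1" if "a \<in> pverts H" for a
    using that c_less[of a] f_less[of a] card_S by (auto simp: c'_def verts)
  moreover have "c' a \<noteq> c' b" if ab: "(a, b) \<in> parcs H" for a b
  proof
    assume eq: "c' a = c' b"
    have "a \<noteq> b" using ab H.no_loops' by blast
    moreover have "a \<in> S \<longleftrightarrow> b \<in> S" using ab eq fresh H.in_arcsD1 H.in_arcsD2 by blast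
    ultimately have "a \<notin> S" "b \<notin> S" using eq fresh_inj by blast+
    then show False using eq ab arc_G c_proper by (auto simp: c'_def S_def)
  qed
  moreover have "a = a' \<and> b = b'"
    if ab: "(a, b) \<in> parcs H" "(a', b') \<in> parcs H" and eq: "c' a = c' a'" "c' b = c' b'"
    for a b a' b'
  proof -
    have sym: "(b, a) \<in> parcs H" "(b', a') \<in> parcs H" using ab H.arcs_symmetric by blast+
    have S: "a \<in> S \<longleftrightarrow> a' \<in> S" "b \<in> S \<longleftrightarrow> b' \<in> S"
      using ab eq fresh H.in_arcsD1 H.in_arcsD2 by blast+
    show ?thesis
    proof (cases "a \<in> S")
      case True
      then have "a = a'" using S eq fresh_inj by blast
      then show ?thesis using S ab eq fresh_inj mixed by blast
    next
      case a: False
      show ?thesis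
      proof (cases "b \<in> S")
        case True
        then have "b = b'" using S eq fresh_inj by blast
        then show ?thesis using S sym eq a mixed by blast
      next
        case False
        then have "c a = c a'" "c b = c b'" using a S eq by (auto simp: c'_def)
        moreover have "(a, b) \<in> parcs G" "(a', b') \<in> parcs G"
          using a False S ab arc_G by (auto simp: S_def)
        ultimately show ?thesis using c_inj by blast
      qed
    qed
  qed
  ultimately have "harmonious_coloring H (k + degree G w + 1) c'"
    unfolding harmonious_coloring_iff_arc_inj[OF pair_graph_image] by blast
  then show ?thesis by blast
qed

section \<open>Bounds for the harmonious chromatic number\<close>

lemma harmonious_chromatic_number_le_image:
  "harmonious_chromatic_number G \<le> harmonious_chromatic_number H"
  using harmonious_chromatic_number_attained[OF pair_graph_image]
    harmonious_coloring_pullback harmonious_chromatic_number_le by blast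

lemma harmonious_chromatic_number_image_le:
  assumes "w = u \<or> w = v"
  shows "harmonious_chromatic_number H \<le> harmonious_chromatic_number G + degree G w + 1"
  using harmonious_chromatic_number_attained[OF pair_graph_axioms]
    harmonious_coloring_pushforward[OF _ assms] harmonious_chromatic_number_le by blast

end

theorem theorem3:
  fixes G :: "'a pair_pre_digraph" and u v :: 'a and \<epsilon> :: "'a \<Rightarrow> 'a"
  assumes "pair_graph G"
    and "elementary_harmonious_hom G u v \<epsilon>"
    and "(u, v) \<notin> parcs G"
  shows "harmonious_chromatic_number G \<le> harmonious_chromatic_number (elementary_image G v \<epsilon>) \<and>
      harmonious_chromatic_number (elementary_image G v \<epsilon>)
        \<le> harmonious_chromatic_number G + min (degree G u) (degree G v) + 1 \<and>
      harmonious_chromatic_number (elementary_image G v \<epsilon>)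
        \<le> harmonious_chromatic_number G + max_degree G + 1"
proof -
  interpret vertex_identification G u v \<epsilon>
    using assms by (simp add: vertex_identification_def vertex_identification_axioms_def)
  have "harmonious_chromatic_number H \<le> harmonious_chromatic_number G + degree G u + 1"
    and "harmonious_chromatic_number H \<le> harmonious_chromatic_number G + degree G v + 1"
    by (rule harmonious_chromatic_number_image_le; simp)+
  then show ?thesis
    using harmonious_chromatic_number_le_image degree_le_max_degree[OF assms(1) u_in_verts]
    by (simp add: min_def)
qed

end
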